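(* (Failure of dichotomy.) There exists an $\mathit{MSO}[<]$ formula $\Psi(X,Y)$ such that: (1) there is a C-operator $F$ such that $\mathit{FVsig}\models \forall X.\ \Psi(X,F(X))$; and (2) there is an SC-operator $G$ such that $\mathit{FVsig}\models \forall Y.\ \neg\Psi(G(Y),Y)$.
   Context: A (finitely variable) boolean signal is a function $f:\mathbb{R}^{\geq 0}\to\{0,1\}$ for which there is an unbounded strictly increasing sequence $0=\tau_0<\tau_1<\cdots$ of reals such that $f$ is constant on every open interval $(\tau_i,\tau_{i+1})$; a signal is identified with the subset of $\mathbb{R}^{\geq 0}$ where it is $1$. $\mathit{MSO}[<]$ is monadic second-order logic with atomic formulas $t<v$ and $X(t)$, boolean connectives, and first- and second-order quantifiers. $\mathit{FVsig}$ is the structure in which first-order variables range over $\mathbb{R}^{\geq 0}$ with its usual order and monadic second-order variables range over the finitely variable boolean signals. An operator is a function $F$ from signals to signals. $F$ is a C-operator (causal) if for every $t\geq 0$ and all signals $X_1,X_2$ that agree on $[0,t]$, $F(X_1)(t)=F(X_2)(t)$; $F$ is an SC-operator (strongly causal) if this holds whenever $X_1,X_2$ agree on $[0,t)$. *)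

theory Defs
  imports Complex_Main "HOL-Library.FuncSet"
begin

text \<open>A boolean signal is represented by the subset of the nonnegative reals on which it is 1.\<close>

definition signals :: "real set set" where
  "signals = {X. X \<subseteq> {0..} \<and>
     (\<exists>\<tau> :: nat \<Rightarrow> real. \<tau> 0 = 0 \<and> strict_mono \<tau> \<and> \<not> bdd_above (range \<tau>) \<and>
        (\<forall>i. \<forall>s\<in>{\<tau> i<..<\<tau> (Suc i)}. \<forall>t\<in>{\<tau> i<..<\<tau> (Suc i)}. s \<in> X \<longleftrightarrow> t \<in> X))}"

text \<open>First-order and monadic second-order variables are both named by natural numbers,
  in separate name spaces.\<close>

datatype mso =
    Less nat nat
  | Mem nat nat  \<comment> \<open>\<open>Mem X t\<close> is the atom \<open>X(t)\<close>\<close>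
  | Neg mso
  | Conj mso mso
  | Disj mso mso
  | Ex1 nat mso
  | All1 nat mso
  | Ex2 nat mso
  | All2 nat mso

primrec free1 :: "mso \<Rightarrow> nat set" where
  "free1 (Less t v) = {t, v}"
| "free1 (Mem X t) = {t}"
| "free1 (Neg \<phi>) = free1 \<phi>"
| "free1 (Conj \<phi> \<psi>) = free1 \<phi> \<union> free1 \<psi>"
| "free1 (Disj \<phi> \<psi>) = free1 \<phi> \<union> free1 \<psi>"
| "free1 (Ex1 t \<phi>) = free1 \<phi> - {t}"
| "free1 (All1 t \<phi>) = free1 \<phi> - {t}"
| "free1 (Ex2 X \<phi>) = free1 \<phi>"
| "free1 (All2 X \<phi>) = free1 \<phi>"

primrec free2 :: "mso \<Rightarrow> nat set" where
  "free2 (Less t v) = {}"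
| "free2 (Mem X t) = {X}"
| "free2 (Neg \<phi>) = free2 \<phi>"
| "free2 (Conj \<phi> \<psi>) = free2 \<phi> \<union> free2 \<psi>"
| "free2 (Disj \<phi> \<psi>) = free2 \<phi> \<union> free2 \<psi>"
| "free2 (Ex1 t \<phi>) = free2 \<phi>"
| "free2 (All1 t \<phi>) = free2 \<phi>"
| "free2 (Ex2 X \<phi>) = free2 \<phi> - {X}"
| "free2 (All2 X \<phi>) = free2 \<phi> - {X}"

text \<open>Satisfaction in the structure \<open>FVsig\<close>.\<close>

primrec FVsig_sat :: "(nat \<Rightarrow> real) \<Rightarrow> (nat \<Rightarrow> real set) \<Rightarrow> mso \<Rightarrow> bool" where
  "FVsig_sat e E (Less t v) \<longleftrightarrow> e t < e v"
| "FVsig_sat e E (Mem X t) \<longleftrightarrow> e t \<in> E X"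
| "FVsig_sat e E (Neg \<phi>) \<longleftrightarrow> \<not> FVsig_sat e E \<phi>"
| "FVsig_sat e E (Conj \<phi> \<psi>) \<longleftrightarrow> FVsig_sat e E \<phi> \<and> FVsig_sat e E \<psi>"
| "FVsig_sat e E (Disj \<phi> \<psi>) \<longleftrightarrow> FVsig_sat e E \<phi> \<or> FVsig_sat e E \<psi>"
| "FVsig_sat e E (Ex1 t \<phi>) \<longleftrightarrow> (\<exists>a\<in>{0..}. FVsig_sat (e(t := a)) E \<phi>)"
| "FVsig_sat e E (All1 t \<phi>) \<longleftrightarrow> (\<forall>a\<in>{0..}. FVsig_sat (e(t := a)) E \<phi>)"
| "FVsig_sat e E (Ex2 X \<phi>) \<longleftrightarrow> (\<exists>A\<in>signals. FVsig_sat e (E(X := A)) \<phi>)"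
| "FVsig_sat e E (All2 X \<phi>) \<longleftrightarrow> (\<forall>A\<in>signals. FVsig_sat e (E(X := A)) \<phi>)"

lemma FVsig_sat_cong:
  assumes "\<And>t. t \<in> free1 \<phi> \<Longrightarrow> e t = e' t" and "\<And>X. X \<in> free2 \<phi> \<Longrightarrow> E X = E' X"
  shows "FVsig_sat e E \<phi> \<longleftrightarrow> FVsig_sat e' E' \<phi>"
  using assms
proof (induction \<phi> arbitrary: e e' E E')
  case (Ex1 t \<phi>)
  have "FVsig_sat (e(t := a)) E \<phi> \<longleftrightarrow> FVsig_sat (e'(t := a)) E' \<phi>" for a
    by (rule Ex1.IH) (use Ex1.prems in auto)
  then show ?case by simp
next
  case (All1 t \<phi>)
  have "FVsig_sat (e(t := a)) E \<phi> \<longleftrightarrow> FVsig_sat (e'(t := a)) E' \<phi>" for a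
    by (rule All1.IH) (use All1.prems in auto)
  then show ?case by simp
next
  case (Ex2 X \<phi>)
  have "FVsig_sat e (E(X := A)) \<phi> \<longleftrightarrow> FVsig_sat e' (E'(X := A)) \<phi>" for A
    by (rule Ex2.IH) (use Ex2.prems in auto)
  then show ?case by simp
next
  case (All2 X \<phi>)
  have "FVsig_sat e (E(X := A)) \<phi> \<longleftrightarrow> FVsig_sat e' (E'(X := A)) \<phi>" for A
    by (rule All2.IH) (use All2.prems in auto)
  then show ?case by simp
next
  case (Neg \<phi>)
  have "FVsig_sat e E \<phi> \<longleftrightarrow> FVsig_sat e' E' \<phi>"
    by (rule Neg.IH) (use Neg.prems in auto)
  then show ?case by simp
next
  case (Conj \<phi> \<psi>)
  have "FVsig_sat e E \<phi> \<longleftrightarrow> FVsig_sat e' E' \<phi>" "FVsig_sat e E \<psi> \<longleftrightarrow> FVsig_sat e' E' \<psi>"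
    by (rule Conj.IH; use Conj.prems in auto)+
  then show ?case by simp
next
  case (Disj \<phi> \<psi>)
  have "FVsig_sat e E \<phi> \<longleftrightarrow> FVsig_sat e' E' \<phi>" "FVsig_sat e E \<psi> \<longleftrightarrow> FVsig_sat e' E' \<psi>"
    by (rule Disj.IH; use Disj.prems in auto)+
  then show ?case by simp
qed auto

text \<open>Formulas \<open>\<Psi>(X, Y)\<close>: the free variables \<open>X\<close> and \<open>Y\<close> are the second-order variables
  0 and 1.\<close>

definition XY_formula :: "mso \<Rightarrow> bool" where
  "XY_formula \<psi> \<longleftrightarrow> free1 \<psi> = {} \<and> free2 \<psi> \<subseteq> {0, 1}"

text \<open>The values assigned to all other variables are irrelevant for such formulas, see
  \<open>FVsig_holds_iff\<close> below.\<close>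

definition FVsig_holds :: "mso \<Rightarrow> real set \<Rightarrow> real set \<Rightarrow> bool" where
  "FVsig_holds \<psi> X Y \<longleftrightarrow> FVsig_sat (\<lambda>_. 0) ((\<lambda>_. {})(0 := X, 1 := Y)) \<psi>"

lemma FVsig_holds_iff:
  assumes "XY_formula \<psi>"
  shows "FVsig_holds \<psi> X Y \<longleftrightarrow> FVsig_sat e (E(0 := X, 1 := Y)) \<psi>"
  unfolding FVsig_holds_def
  by (rule FVsig_sat_cong) (use assms in \<open>auto simp: XY_formula_def\<close>)

text \<open>Operators are functions on signals; their values outside \<^const>\<open>signals\<close> are irrelevant.\<close>

definition C_operator :: "(real set \<Rightarrow> real set) \<Rightarrow> bool" where
  "C_operator F \<longleftrightarrow> F \<in> signals \<rightarrow> signals \<and>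
     (\<forall>t\<ge>0. \<forall>X\<^sub>1\<in>signals. \<forall>X\<^sub>2\<in>signals.
        (\<forall>s\<in>{0..t}. s \<in> X\<^sub>1 \<longleftrightarrow> s \<in> X\<^sub>2) \<longrightarrow> (t \<in> F X\<^sub>1 \<longleftrightarrow> t \<in> F X\<^sub>2))"

definition SC_operator :: "(real set \<Rightarrow> real set) \<Rightarrow> bool" where
  "SC_operator F \<longleftrightarrow> F \<in> signals \<rightarrow> signals \<and>
     (\<forall>t\<ge>0. \<forall>X\<^sub>1\<in>signals. \<forall>X\<^sub>2\<in>signals.
        (\<forall>s\<in>{0..<t}. s \<in> X\<^sub>1 \<longleftrightarrow> s \<in> X\<^sub>2) \<longrightarrow> (t \<in> F X\<^sub>1 \<longleftrightarrow> t \<in> F X\<^sub>2))"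

end

theory Submission
  imports Defs
begin

text \<open>Take \<open>\<Psi>(X, Y)\<close> to be \<open>X = Y\<close> and \<open>F\<close> the identity. A strongly causal operator on finitely
  variable signals need not have a fixed point: let \<open>G(Y)(t)\<close> be the negation of the left limit
  of \<open>Y\<close> at \<open>t\<close>. On an open interval where \<open>Y\<close> is constant, \<open>G(Y)\<close> is constant with the opposite
  value, so \<open>G(Y)\<close> is a signal different from \<open>Y\<close>.\<close>

text \<open>The bound \<open>0 \<le> r\<close> keeps the window inside the time axis and forces
  \<open>t > 0\<close>, so the value at 0, where no left limit exists, defaults to 0.\<close>

definition neg_left_limit :: "real set \<Rightarrow> real set" where
  "neg_left_limit Y = {t. \<exists>r\<in>{0..<t}. \<forall>s\<in>{r<..<t}. s \<notin> Y}"

lemma neg_left_limit_flips: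
  assumes "0 \<le> a" "t \<in> {a<..<b}"
    and const: "\<forall>s\<in>{a<..<b}. \<forall>t\<in>{a<..<b}. s \<in> Y \<longleftrightarrow> t \<in> Y"
  shows "t \<in> neg_left_limit Y \<longleftrightarrow> t \<notin> Y"
proof
  assume "t \<in> neg_left_limit Y"
  then obtain r where r: "r < t" "\<forall>s\<in>{r<..<t}. s \<notin> Y"
    by (auto simp: neg_left_limit_def)
  \<comment> \<open>Such an \<open>s\<close> lies both in the window where \<open>Y\<close> vanishes
    and in the interval where \<open>Y\<close> is constant.\<close>
  obtain s where s: "max a r < s" "s < t"
    using dense[of "max a r" t] assms(2) r(1) by auto
  then have "s \<notin> Y" "s \<in> {a<..<b}"
    using r assms(2) by auto
  then show "t \<notin> Y"
    using const assms(2) by blast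
next
  assume "t \<notin> Y"
  then have "\<forall>s\<in>{a<..<t}. s \<notin> Y"
    using const assms(2) by fastforce
  then show "t \<in> neg_left_limit Y"
    using assms(1,2) by (auto simp: neg_left_limit_def)
qed

text \<open>By the flip, the sequence \<open>\<tau>\<close> for \<open>Y\<close> also serves for its
  image, and any point of the first interval separates the two.\<close>

lemma neg_left_limit_signal:
  assumes "Y \<in> signals"
  shows "neg_left_limit Y \<in> signals" and "neg_left_limit Y \<noteq> Y"
proof -
  obtain \<tau> :: "nat \<Rightarrow> real" where \<tau>: "\<tau> 0 = 0" "strict_mono \<tau>" "\<not> bdd_above (range \<tau>)"
    and const: "\<forall>i. \<forall>s\<in>{\<tau> i<..<\<tau> (Suc i)}. \<forall>t\<in>{\<tau> i<..<\<tau> (Suc i)}. s \<in> Y \<longleftrightarrow> t \<in> Y"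
    using assms unfolding signals_def mem_Collect_eq by (elim conjE exE)
  have "0 \<le> \<tau> i" for i
    using \<tau>(1,2) strict_mono_less_eq[of \<tau> 0 i] by simp
  then have flip: "t \<in> neg_left_limit Y \<longleftrightarrow> t \<notin> Y" if "t \<in> {\<tau> i<..<\<tau> (Suc i)}" for i t
    using neg_left_limit_flips[OF _ that spec[OF const, of i]] by blast
  then have "\<forall>i. \<forall>s\<in>{\<tau> i<..<\<tau> (Suc i)}. \<forall>t\<in>{\<tau> i<..<\<tau> (Suc i)}.
      s \<in> neg_left_limit Y \<longleftrightarrow> t \<in> neg_left_limit Y"
    using const by blast
  moreover have "neg_left_limit Y \<subseteq> {0..}"
    by (auto simp: neg_left_limit_def)
  ultimately show "neg_left_limit Y \<in> signals"
    using \<tau> unfolding signals_def mem_Collect_eq by (intro conjI exI[of _ \<tau>])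
  obtain t where "t \<in> {\<tau> 0<..<\<tau> (Suc 0)}"
    using dense[of "\<tau> 0" "\<tau> (Suc 0)"] \<tau>(2) by (auto simp: strict_mono_less)
  then show "neg_left_limit Y \<noteq> Y"
    using flip by blast
qed

lemma SC_operator_neg_left_limit: "SC_operator neg_left_limit"
  unfolding SC_operator_def
proof (intro conjI allI impI ballI)
  show "neg_left_limit \<in> signals \<rightarrow> signals"
    using neg_left_limit_signal(1) by blast
next
  fix t :: real and X\<^sub>1 X\<^sub>2
  assume "\<forall>s\<in>{0..<t}. s \<in> X\<^sub>1 \<longleftrightarrow> s \<in> X\<^sub>2"
  \<comment> \<open>Since \<open>r \<ge> 0\<close>, the window lies in \<open>[0,t)\<close>, where
    the two inputs agree.\<close>
  then have "(\<forall>s\<in>{r<..<t}. s \<notin> X\<^sub>1) \<longleftrightarrow> (\<forall>s\<in>{r<..<t}. s \<notin> X\<^sub>2)" if "r \<in> {0..<t}" for r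
    using that by auto
  then show "t \<in> neg_left_limit X\<^sub>1 \<longleftrightarrow> t \<in> neg_left_limit X\<^sub>2"
    by (auto simp: neg_left_limit_def)
qed

text \<open>The language has neither second-order equality nor a biconditional, so extensionality is
  written with two clauses.\<close>

definition eq_formula :: mso where
  "eq_formula = All1 0 (Conj (Disj (Neg (Mem 0 0)) (Mem 1 0)) (Disj (Mem 0 0) (Neg (Mem 1 0))))"

lemma XY_formula_eq_formula: "XY_formula eq_formula"
  by (auto simp: XY_formula_def eq_formula_def)

lemma FVsig_holds_eq_formula:
  assumes "X \<in> signals" "Y \<in> signals"
  shows "FVsig_holds eq_formula X Y \<longleftrightarrow> X = Y"
proof -
  \<comment> \<open>The quantifier sees only nonnegative reals, so full set equality needs these
    inclusions.\<close>
  have "X \<subseteq> {0..}" "Y \<subseteq> {0..}"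
    using assms by (auto simp: signals_def)
  moreover have "FVsig_holds eq_formula X Y \<longleftrightarrow> (\<forall>a\<in>{0..}. a \<in> X \<longleftrightarrow> a \<in> Y)"
    by (auto simp: FVsig_holds_def eq_formula_def)
  ultimately show ?thesis
    by blast
qed

theorem theorem1p3:
  shows "\<exists>\<Psi> :: mso. XY_formula \<Psi> \<and>
    (\<exists>F. C_operator F \<and> (\<forall>X\<in>signals. FVsig_holds \<Psi> X (F X))) \<and>
    (\<exists>G. SC_operator G \<and> (\<forall>Y\<in>signals. \<not> FVsig_holds \<Psi> (G Y) Y))"
proof (intro exI conjI)
  show "XY_formula eq_formula"
    by (rule XY_formula_eq_formula)
  show "C_operator id"
    by (auto simp: C_operator_def)
  show "\<forall>X\<in>signals. FVsig_holds eq_formula X (id X)"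
    by (simp add: FVsig_holds_eq_formula)
  show "SC_operator neg_left_limit"
    by (rule SC_operator_neg_left_limit)
  show "\<forall>Y\<in>signals. \<not> FVsig_holds eq_formula (neg_left_limit Y) Y"
    by (simp add: FVsig_holds_eq_formula neg_left_limit_signal)
qed

end
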